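(* Let $G$ be a compact abelian topological group, let $f:G\to G$ be a continuous automorphism, and let $\tilde f:G/\mathrm{CC}(f)\to G/\mathrm{CC}(f)$ be the map induced by $f$. Then $\mathrm{CC}(\tilde f)=\{\mathrm{CC}(f)\}$, i.e. the chain component of the identity for $\tilde f$ consists only of the identity coset $\mathrm{CC}(f)\in G/\mathrm{CC}(f)$.
   Context: For a topological group $G$ with identity $e$, $\mathfrak{B}_e$ is a fundamental system of symmetric neighborhoods of $e$. For a continuous endomorphism $g$ of $G$, $E\in\mathfrak{B}_e$ and $x,y\in G$, an $E$-chain of $g$ from $x$ to $y$ is a finite sequence $x_0,\dots,x_n$ in $G$ ($n\ge 1$) with $x_0=x$, $x_n=y$ and $g(x_i)x_{i+1}^{-1}\in E$ for $0\le i\le n-1$. Write $x\rightsquigarrow y$ if for every $E\in\mathfrak{B}_e$ there is an $E$-chain of $g$ from $x$ to $y$. The chain component of the identity is $\mathrm{CC}(g)=\{x\in G : x\rightsquigarrow e\text{ and }e\rightsquigarrow x\}$; it is a closed subgroup with $g(\mathrm{CC}(g))\subseteq \mathrm{CC}(g)$. For a closed subgroup $H$ of $G$ with $f(H)\subseteq H$, $G/H$ is the quotient topological group with projection $\pi:G\to G/H$, the sets $\pi(E)$, $E\in\mathfrak{B}_e$, serve as the fundamental system of symmetric neighborhoods of its identity, and the induced (canonical) map is $\tilde f(xH)=f(x)H$. *)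

theory Defs
  imports "HOL-Analysis.Analysis" "HOL-Algebra.Coset"
begin

text \<open>Topological groups are given by a group \<open>G\<close> and an abstract topology \<open>T\<close> whose underlying
  set is \<open>carrier G\<close>. No separation axiom is imposed.\<close>

locale topological_group = group G for G (structure) and T :: "'a topology" +
  assumes topspace_eq: "topspace T = carrier G"
    and continuous_mult: "continuous_map (prod_topology T T) T (\<lambda>(x, y). x \<otimes> y)"
    and continuous_inv: "continuous_map T T (\<lambda>x. inv x)"

text \<open>A neighborhood is a set containing an open set around the point; it need not itself be
  open.\<close>

definition symmetric_nhds_system ::
    "('a, 'b) monoid_scheme \<Rightarrow> 'a topology \<Rightarrow> 'a set set \<Rightarrow> bool" where
  "symmetric_nhds_system G T \<B> \<longleftrightarrow>
     (\<forall>E\<in>\<B>. E \<subseteq> carrier G \<and> (\<exists>U. openin T U \<and> \<one>\<^bsub>G\<^esub> \<in> U \<and> U \<subseteq> E)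
        \<and> (\<lambda>x. inv\<^bsub>G\<^esub> x) ` E = E) \<and>
     (\<forall>U. openin T U \<and> \<one>\<^bsub>G\<^esub> \<in> U \<longrightarrow> (\<exists>E\<in>\<B>. E \<subseteq> U))"

definition is_chain ::
    "('a, 'b) monoid_scheme \<Rightarrow> ('a \<Rightarrow> 'a) \<Rightarrow> 'a set \<Rightarrow> 'a \<Rightarrow> 'a \<Rightarrow> nat \<Rightarrow> (nat \<Rightarrow> 'a) \<Rightarrow> bool" where
  "is_chain G g E x y n c \<longleftrightarrow>
     n \<ge> 1 \<and> (\<forall>i\<le>n. c i \<in> carrier G) \<and> c 0 = x \<and> c n = y \<and>
     (\<forall>i<n. g (c i) \<otimes>\<^bsub>G\<^esub> inv\<^bsub>G\<^esub> c (Suc i) \<in> E)"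

definition chain_reaches ::
    "('a, 'b) monoid_scheme \<Rightarrow> 'a set set \<Rightarrow> ('a \<Rightarrow> 'a) \<Rightarrow> 'a \<Rightarrow> 'a \<Rightarrow> bool" where
  "chain_reaches G \<B> g x y \<longleftrightarrow> (\<forall>E\<in>\<B>. \<exists>n c. is_chain G g E x y n c)"

definition chain_component ::
    "('a, 'b) monoid_scheme \<Rightarrow> 'a set set \<Rightarrow> ('a \<Rightarrow> 'a) \<Rightarrow> 'a set" where
  "chain_component G \<B> g =
     {x \<in> carrier G. chain_reaches G \<B> g x \<one>\<^bsub>G\<^esub> \<and> chain_reaches G \<B> g \<one>\<^bsub>G\<^esub> x}"

text \<open>The library's quotient \<open>G Mod H\<close> consists of the cosets \<open>H #> x\<close>; for normal \<open>H\<close>, in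
  particular for abelian \<open>G\<close>, these are the cosets \<open>x <# H\<close>.\<close>

abbreviation coset_proj :: "('a, 'b) monoid_scheme \<Rightarrow> 'a set \<Rightarrow> 'a \<Rightarrow> 'a set" where
  "coset_proj G H \<equiv> \<lambda>x. H #>\<^bsub>G\<^esub> x"

definition quotient_nhds ::
    "('a, 'b) monoid_scheme \<Rightarrow> 'a set \<Rightarrow> 'a set set \<Rightarrow> 'a set set set" where
  "quotient_nhds G H \<B> = (\<lambda>E. coset_proj G H ` E) ` \<B>"

text \<open>The induced map sends \<open>H #> x\<close> to \<open>H #> f x\<close>; see \<open>induced_map_coset\<close> below for
  independence of the representative.\<close>

definition induced_map ::
    "('a, 'b) monoid_scheme \<Rightarrow> 'a set \<Rightarrow> ('a \<Rightarrow> 'a) \<Rightarrow> 'a set \<Rightarrow> 'a set" where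
  "induced_map G H f C = the_elem ((\<lambda>x. coset_proj G H (f x)) ` C)"

lemma induced_map_coset:
  assumes "group G" "subgroup H G" "f \<in> hom G G" "f ` H \<subseteq> H" "x \<in> carrier G"
  shows "induced_map G H f (H #>\<^bsub>G\<^esub> x) = H #>\<^bsub>G\<^esub> f x"
proof -
  interpret group G by fact
  interpret H: subgroup H G by fact
  have fc: "f y \<in> carrier G" if "y \<in> carrier G" for y
    using assms(3) that by (auto simp: hom_def)
  have "H #>\<^bsub>G\<^esub> f y = H #>\<^bsub>G\<^esub> f x" if y: "y \<in> H #>\<^bsub>G\<^esub> x" for y
  proof -
    obtain h where h: "h \<in> H" "y = h \<otimes>\<^bsub>G\<^esub> x"
      using y by (auto simp: r_coset_def)
    have fy: "f y = f h \<otimes>\<^bsub>G\<^esub> f x"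
      using h assms(3,5) by (simp add: hom_mult)
    have "f h \<in> H" using h assms(4) by blast
    hence fh: "H #>\<^bsub>G\<^esub> f h = H" "f h \<in> carrier G"
      using assms(2) H.mem_carrier by (simp_all add: coset_join2)
    have "H #>\<^bsub>G\<^esub> f h #>\<^bsub>G\<^esub> f x = H #>\<^bsub>G\<^esub> (f h \<otimes>\<^bsub>G\<^esub> f x)"
      by (rule coset_mult_assoc[OF H.subset fh(2) fc[OF assms(5)]])
    thus ?thesis by (simp only: fy fh(1))
  qed
  moreover have "x \<in> H #>\<^bsub>G\<^esub> x"
    using assms(2,5) by (simp add: rcos_self)
  ultimately have "(\<lambda>y. H #>\<^bsub>G\<^esub> f y) ` (H #>\<^bsub>G\<^esub> x) = {H #>\<^bsub>G\<^esub> f x}"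
    by blast
  thus ?thesis
    by (simp add: induced_map_def)
qed

text \<open>Consistency with the quotient topology: any topology \<open>Q\<close> making the projection a quotient
  map turns \<open>G Mod H\<close> into a topological group for which the images of the given neighborhoods
  again form a fundamental system of symmetric neighborhoods of the identity.\<close>

context topological_group
begin

lemma continuous_translation:
  assumes "h \<in> carrier G"
  shows "continuous_map T T (\<lambda>x. h \<otimes> x)"
proof -
  have "continuous_map T (prod_topology T T) (\<lambda>x. (h, x))"
    using assms topspace_eq by (intro continuous_map_pairedI) auto
  from continuous_map_compose[OF this continuous_mult] show ?thesis
    by (simp add: o_def)
qed

lemma open_translation:
  assumes "h \<in> carrier G" "openin T U"
  shows "openin T {x \<in> carrier G. h \<otimes> x \<in> U}"
  using openin_continuous_map_preimage[OF continuous_translation[OF assms(1)] assms(2)]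
  by (simp add: topspace_eq)

lemma open_map_coset_proj:
  assumes H: "subgroup H G" and Q: "quotient_map T Q (coset_proj G H)"
  shows "open_map T Q (coset_proj G H)"
  unfolding open_map_def
proof (intro allI impI)
  fix U assume U: "openin T U"
  have Us: "U \<subseteq> carrier G" using openin_subset[OF U] topspace_eq by simp
  have Hs: "H \<subseteq> carrier G" using H by (rule subgroup.subset)
  have "{x \<in> topspace T. coset_proj G H x \<in> coset_proj G H ` U}
      = (\<Union>h\<in>H. {x \<in> carrier G. h \<otimes> x \<in> U})" (is "?L = ?R")
  proof
    show "?L \<subseteq> ?R"
    proof
      fix x assume "x \<in> ?L"
      then obtain u where x: "x \<in> carrier G" and u: "u \<in> U" "H #> x = H #> u"
        by (auto simp: topspace_eq)
      have "u \<in> H #> x" unfolding u(2) using u(1) Us H by (intro rcos_self) auto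
      thus "x \<in> ?R" using x u by (auto simp: r_coset_def)
    qed
    show "?R \<subseteq> ?L"
    proof
      fix x assume "x \<in> ?R"
      then obtain h where h: "h \<in> H" "x \<in> carrier G" "h \<otimes> x \<in> U" by auto
      have hc: "h \<in> carrier G" using h Hs by blast
      have "H #> (h \<otimes> x) = H #> h #> x"
        by (rule coset_mult_assoc[OF Hs hc h(2), symmetric])
      hence "H #> (h \<otimes> x) = H #> x"
        using coset_join2[OF hc H h(1)] by simp
      thus "x \<in> ?L" using h by (auto simp: topspace_eq intro!: image_eqI[of _ _ "h \<otimes> x"])
    qed
  qed
  moreover have "openin T ?R"
    using open_translation[OF _ U] Hs by (intro openin_Union) auto
  moreover have "coset_proj G H ` U \<subseteq> topspace Q"
    using Q Us topspace_eq unfolding quotient_map_def by blast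
  moreover have "openin Q V \<longleftrightarrow> openin T {x \<in> topspace T. coset_proj G H x \<in> V}"
    if "V \<subseteq> topspace Q" for V
    using Q that unfolding quotient_map_def by blast
  ultimately show "openin Q (coset_proj G H ` U)" by (simp only:)
qed

lemma topological_group_quotient:
  assumes H: "H \<lhd> G" and Q: "quotient_map T Q (coset_proj G H)"
  shows "topological_group (G Mod H) Q"
proof -
  interpret H: normal H G by fact
  let ?p = "coset_proj G H"
  have sub: "subgroup H G" by (rule H.is_subgroup)
  have op: "open_map T Q ?p" by (rule open_map_coset_proj[OF sub Q])
  have cont: "continuous_map T Q ?p" by (rule quotient_imp_continuous_map[OF Q])
  have surj: "?p ` topspace T = topspace Q" by (rule quotient_imp_surjective_map[OF Q])
  have grp: "group (G Mod H)" by (rule H.factorgroup_is_group)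
  have mul: "?p x \<otimes>\<^bsub>G Mod H\<^esub> ?p y = ?p (x \<otimes> y)" if "x \<in> carrier G" "y \<in> carrier G" for x y
    by (rule hom_mult[OF H.r_coset_hom_Mod that, symmetric])
  have pinv: "inv\<^bsub>G Mod H\<^esub> (?p x) = ?p (inv x)" if "x \<in> carrier G" for x
  proof -
    have "?p x \<in> carrier (G Mod H)" using that by (simp add: carrier_FactGroup)
    from H.inv_FactGroup[OF this] H.rcos_inv[OF that] show ?thesis by (rule trans)
  qed
  show ?thesis
  proof (intro topological_group.intro topological_group_axioms.intro grp)
    show "topspace Q = carrier (G Mod H)"
      using surj by (simp add: carrier_FactGroup topspace_eq)
    have "continuous_map T Q (\<lambda>x. ?p (inv x))"
      using continuous_map_compose[OF continuous_inv cont] by (simp add: o_def)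
    hence "continuous_map T Q ((\<lambda>X. inv\<^bsub>G Mod H\<^esub> X) \<circ> ?p)"
      by (rule continuous_map_eq) (simp add: pinv topspace_eq)
    thus "continuous_map Q Q (\<lambda>X. inv\<^bsub>G Mod H\<^esub> X)"
      using Q by (rule continuous_compose_quotient_map[rotated])
    have pp: "quotient_map (prod_topology T T) (prod_topology Q Q) (\<lambda>(x, y). (?p x, ?p y))"
    proof (rule continuous_open_imp_quotient_map)
      show "continuous_map (prod_topology T T) (prod_topology Q Q) (\<lambda>(x, y). (?p x, ?p y))"
        using cont by (simp add: continuous_map_prod_top)
      show "open_map (prod_topology T T) (prod_topology Q Q) (\<lambda>(x, y). (?p x, ?p y))"
        unfolding open_map_def
      proof (intro allI impI)
        fix W assume W: "openin (prod_topology T T) W"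
        show "openin (prod_topology Q Q) ((\<lambda>(x, y). (?p x, ?p y)) ` W)"
          unfolding openin_prod_topology_alt
        proof (intro allI impI)
          fix X Y assume "(X, Y) \<in> (\<lambda>(x, y). (?p x, ?p y)) ` W"
          then obtain x y where xy: "(x, y) \<in> W" "X = ?p x" "Y = ?p y" by auto
          from W xy(1) obtain U V where UV: "openin T U" "openin T V" "x \<in> U" "y \<in> V" "U \<times> V \<subseteq> W"
            unfolding openin_prod_topology_alt by meson
          have o: "openin Q (?p ` U)" "openin Q (?p ` V)"
            using op UV(1,2) unfolding open_map_def by blast+
          have m: "X \<in> ?p ` U" "Y \<in> ?p ` V"
            using imageI[OF UV(3), of ?p] imageI[OF UV(4), of ?p] xy(2,3) by simp_all
          have "?p ` U \<times> ?p ` V \<subseteq> (\<lambda>(x, y). (?p x, ?p y)) ` W"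
          proof clarify
            fix a b assume "a \<in> U" "b \<in> V"
            hence "(a, b) \<in> W" using UV(5) by blast
            thus "(?p a, ?p b) \<in> (\<lambda>(x, y). (?p x, ?p y)) ` W"
              by (rule rev_image_eqI) simp
          qed
          with o m show "\<exists>U V. openin Q U \<and> openin Q V \<and> X \<in> U \<and> Y \<in> V
              \<and> U \<times> V \<subseteq> (\<lambda>(x, y). (?p x, ?p y)) ` W"
            by (intro exI conjI)
        qed
      qed
      show "(\<lambda>(x, y). (?p x, ?p y)) ` topspace (prod_topology T T) = topspace (prod_topology Q Q)"
        by (simp only: topspace_prod_topology surj[symmetric] map_prod_def[symmetric] map_prod_surj_on[OF refl refl])
    qed
    have "continuous_map (prod_topology T T) Q (?p \<circ> (\<lambda>(x, y). x \<otimes> y))"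
      by (rule continuous_map_compose[OF continuous_mult cont])
    hence "continuous_map (prod_topology T T) Q
        ((\<lambda>(X, Y). X \<otimes>\<^bsub>G Mod H\<^esub> Y) \<circ> (\<lambda>(x, y). (?p x, ?p y)))"
      by (rule continuous_map_eq) (auto simp: mul topspace_eq simp del: mult_FactGroup)
    with pp show "continuous_map (prod_topology Q Q) Q (\<lambda>(X, Y). X \<otimes>\<^bsub>G Mod H\<^esub> Y)"
      by (rule continuous_compose_quotient_map)
  qed
qed

lemma symmetric_nhds_system_quotient:
  assumes H: "H \<lhd> G" and Q: "quotient_map T Q (coset_proj G H)"
    and B: "symmetric_nhds_system G T \<B>"
  shows "symmetric_nhds_system (G Mod H) Q (quotient_nhds G H \<B>)"
proof -
  interpret H: normal H G by fact
  let ?p = "coset_proj G H"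
  have sub: "subgroup H G" by (rule H.is_subgroup)
  have op: "open_map T Q ?p" by (rule open_map_coset_proj[OF sub Q])
  have cont: "continuous_map T Q ?p" by (rule quotient_imp_continuous_map[OF Q])
  have p1: "?p \<one> = H" by (simp add: H.subset)
  have pinv: "inv\<^bsub>G Mod H\<^esub> (?p x) = ?p (inv x)" if "x \<in> carrier G" for x
  proof -
    have "?p x \<in> carrier (G Mod H)" using that by (simp add: carrier_FactGroup)
    from H.inv_FactGroup[OF this] H.rcos_inv[OF that] show ?thesis by (rule trans)
  qed
  show ?thesis
    unfolding symmetric_nhds_system_def quotient_nhds_def
  proof (intro conjI ballI allI impI)
    fix F assume "F \<in> (\<lambda>E. ?p ` E) ` \<B>"
    then obtain E where E: "E \<in> \<B>" "F = ?p ` E" by auto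
    have Eprops: "E \<subseteq> carrier G \<and> (\<exists>U. openin T U \<and> \<one> \<in> U \<and> U \<subseteq> E) \<and> (\<lambda>x. inv x) ` E = E"
      using B E(1) unfolding symmetric_nhds_system_def by (elim conjE bspec)
    have Es: "E \<subseteq> carrier G" using Eprops by (rule conjunct1)
    have sym: "(\<lambda>x. inv x) ` E = E" using Eprops by (elim conjE)
    from Eprops obtain U where U: "openin T U" "\<one> \<in> U" "U \<subseteq> E" by (elim conjE exE)
    show "F \<subseteq> carrier (G Mod H)"
      using E(2) Es by (auto simp: carrier_FactGroup)
    have "openin Q (?p ` U)" using op U(1) by (simp add: open_map_def)
    moreover have "\<one>\<^bsub>G Mod H\<^esub> \<in> ?p ` U" using imageI[OF U(2), of ?p] p1 by simp
    moreover have "?p ` U \<subseteq> F" unfolding E(2) by (rule image_mono[OF U(3)])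
    ultimately show "\<exists>V. openin Q V \<and> \<one>\<^bsub>G Mod H\<^esub> \<in> V \<and> V \<subseteq> F"
      by (intro exI conjI)
    have "(\<lambda>X. inv\<^bsub>G Mod H\<^esub> X) ` F = (\<lambda>x. ?p (inv x)) ` E"
      unfolding E(2) image_image using Es pinv by (intro image_cong) auto
    also have "\<dots> = ?p ` ((\<lambda>x. inv x) ` E)" by (simp add: image_image)
    finally show "(\<lambda>X. inv\<^bsub>G Mod H\<^esub> X) ` F = F" by (simp add: sym E(2))
  next
    fix V assume V: "openin Q V \<and> \<one>\<^bsub>G Mod H\<^esub> \<in> V"
    have "openin T {x \<in> topspace T. ?p x \<in> V}"
      using cont V by (intro openin_continuous_map_preimage) auto
    moreover have "\<one> \<in> {x \<in> topspace T. ?p x \<in> V}"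
      using V p1 by (simp add: topspace_eq)
    ultimately have "\<exists>E\<in>\<B>. E \<subseteq> {x \<in> topspace T. ?p x \<in> V}"
      using B unfolding symmetric_nhds_system_def by (elim conjE allE impE) (rule conjI)
    then obtain E where E: "E \<in> \<B>" "E \<subseteq> {x \<in> topspace T. ?p x \<in> V}" by (elim bexE)
    have "?p ` E \<subseteq> V" using E(2) by (intro image_subsetI) (drule subsetD, assumption, simp)
    thus "\<exists>F\<in>(\<lambda>E. ?p ` E) ` \<B>. F \<subseteq> V" by (rule rev_bexI[OF imageI[OF E(1)]])
  qed
qed

end

end

theory Submission
  imports Defs
begin

text \<open>Write \<open>H\<close> for the chain component of \<open>f\<close>. The key observation is that an \<open>E\<close>-chain for a
  quotient by a subgroup \<open>H\<close> lifts to a genuine \<open>E\<close>-chain of \<open>f\<close> in \<open>G\<close> with any prescribed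
  starting representative: a quotient step says \<open>f y \<otimes> inv z = h \<otimes> e\<close> with \<open>h \<in> H\<close> and
  \<open>e \<in> E\<close>, and replacing the representative \<open>z\<close> by \<open>h \<otimes> z\<close> absorbs \<open>h\<close>, so that no error
  accumulates along the chain (\<open>lift_quotient_chain\<close>). Only the endpoint is uncontrolled, and only
  up to an element of \<open>H\<close> depending on \<open>E\<close>.

  If \<open>H #> x\<close> is in the chain component of the induced map, lifting a chain from \<open>H #> x\<close> to
  \<open>H\<close> gives an \<open>E\<close>-chain from \<open>x\<close> to some \<open>h \<in> H\<close>, and \<open>h\<close> is joined to the identity by
  definition of \<open>H\<close>. Lifting a chain from \<open>H\<close> to \<open>H #> x\<close> gives a chain from the identity to some
  \<open>h \<otimes> x\<close>; this endpoint is corrected by multiplying with a chain from the identity to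
  \<open>inv h\<close>. Chains can be multiplied pointwise because \<open>G\<close> is abelian and \<open>f\<close> is a homomorphism,
  and chains of different lengths are matched by waiting at the fixed point \<open>\<one>\<close>
  (\<open>chain_mult_from_one\<close>, \<open>chain_mult_to_one\<close>). The same multiplication shows that \<open>H\<close> is a
  subgroup, and continuity of \<open>f\<close> shows that it is mapped into itself.\<close>

section \<open>Chains as paths of a relation\<close>

definition chain_step ::
    "('a, 'b) monoid_scheme \<Rightarrow> ('a \<Rightarrow> 'a) \<Rightarrow> 'a set \<Rightarrow> ('a \<times> 'a) set" where
  "chain_step G g E =
     {(x, y). x \<in> carrier G \<and> y \<in> carrier G \<and> g x \<otimes>\<^bsub>G\<^esub> inv\<^bsub>G\<^esub> y \<in> E}"

text \<open>Reading chains as a transitive closure makes concatenation transitivity and turns statements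
  about chains into inductions over a single step.\<close>

lemma ex_is_chain_iff_trancl:
  "(\<exists>n c. is_chain G g E x y n c) \<longleftrightarrow> (x, y) \<in> (chain_step G g E)\<^sup>+"
proof
  assume "\<exists>n c. is_chain G g E x y n c"
  then obtain n c where "is_chain G g E x y n c" by blast
  hence "n > 0" "(x, y) \<in> chain_step G g E ^^ n"
    by (auto simp: is_chain_def chain_step_def relpow_fun_conv)
  thus "(x, y) \<in> (chain_step G g E)\<^sup>+"
    by (auto simp: trancl_power)
next
  assume "(x, y) \<in> (chain_step G g E)\<^sup>+"
  then obtain n c where n: "n > 0" and c: "c 0 = x" "c n = y"
    and step: "\<And>i. i < n \<Longrightarrow> (c i, c (Suc i)) \<in> chain_step G g E"
    by (auto simp: trancl_power relpow_fun_conv)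
  have "c i \<in> carrier G" if "i \<le> n" for i
  proof (cases i)
    case 0
    thus ?thesis using step[of 0] n by (simp add: chain_step_def)
  next
    case (Suc j)
    thus ?thesis using step[of j] that by (simp add: chain_step_def)
  qed
  with n c step have "is_chain G g E x y n c"
    by (simp add: is_chain_def chain_step_def)
  thus "\<exists>n c. is_chain G g E x y n c" by blast
qed

lemma chain_reaches_iff_trancl:
  "chain_reaches G \<B> g x y \<longleftrightarrow> (\<forall>E\<in>\<B>. (x, y) \<in> (chain_step G g E)\<^sup>+)"
  by (simp add: chain_reaches_def ex_is_chain_iff_trancl)

section \<open>The chain component as an invariant subgroup\<close>

locale abelian_group_endomorphism = topological_group G T + comm_group G
  for G (structure) and T :: "'a topology" +
  fixes \<B> :: "'a set set" and f :: "'a \<Rightarrow> 'a"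
  assumes nhds: "symmetric_nhds_system G T \<B>"
    and f_hom: "f \<in> hom G G"
    and f_cont: "continuous_map T T f"
begin

lemma f_closed: "x \<in> carrier G \<Longrightarrow> f x \<in> carrier G"
  using f_hom by (auto simp: hom_def)

lemma f_mult: "x \<in> carrier G \<Longrightarrow> y \<in> carrier G \<Longrightarrow> f (x \<otimes> y) = f x \<otimes> f y"
  using f_hom by (simp add: hom_mult)

lemma f_one: "f \<one> = \<one>"
  using hom_one[OF f_hom is_group is_group] .

lemma f_inv: "x \<in> carrier G \<Longrightarrow> f (inv x) = inv (f x)"
  using group_hom.hom_inv[of G G f x] f_hom is_group
  by (simp add: group_hom_def group_hom_axioms_def)

lemma nhdsD:
  assumes "E \<in> \<B>"
  shows "E \<subseteq> carrier G \<and> (\<exists>U. openin T U \<and> \<one> \<in> U \<and> U \<subseteq> E) \<and> (\<lambda>x. inv x) ` E = E"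
  using nhds assms unfolding symmetric_nhds_system_def by (elim conjE bspec)

lemma nhds_subset: "E \<in> \<B> \<Longrightarrow> E \<subseteq> carrier G"
  by (rule conjunct1[OF nhdsD])

lemma nhds_open: "E \<in> \<B> \<Longrightarrow> \<exists>U. openin T U \<and> \<one> \<in> U \<and> U \<subseteq> E"
  by (rule conjunct1[OF conjunct2[OF nhdsD]])

lemma nhds_one: "E \<in> \<B> \<Longrightarrow> \<one> \<in> E"
  using nhds_open by blast

lemma nhds_inv_image: "E \<in> \<B> \<Longrightarrow> (\<lambda>x. inv x) ` E = E"
  by (rule conjunct2[OF conjunct2[OF nhdsD]])

lemma nhds_base:
  assumes "openin T U" "\<one> \<in> U"
  shows "\<exists>E\<in>\<B>. E \<subseteq> U"
  using conjunct2[OF nhds[unfolded symmetric_nhds_system_def]] assms by (elim allE impE) (rule conjI)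

lemma nhds_square_root:
  assumes "E \<in> \<B>"
  shows "\<exists>D\<in>\<B>. \<forall>a\<in>D. \<forall>b\<in>D. a \<otimes> b \<in> E"
proof -
  obtain U where U: "openin T U" "\<one> \<in> U" "U \<subseteq> E"
    using nhds_open[OF assms] by blast
  let ?W = "{p \<in> topspace (prod_topology T T). (\<lambda>(x, y). x \<otimes> y) p \<in> U}"
  have "openin (prod_topology T T) ?W"
    by (rule openin_continuous_map_preimage[OF continuous_mult U(1)])
  moreover have "(\<one>, \<one>) \<in> ?W" using U(2) by (simp add: topspace_eq)
  ultimately obtain V W where VW: "openin T V" "openin T W" "\<one> \<in> V" "\<one> \<in> W" "V \<times> W \<subseteq> ?W"
    unfolding openin_prod_topology_alt by meson
  obtain D where D: "D \<in> \<B>" "D \<subseteq> V \<inter> W"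
    using nhds_base[of "V \<inter> W"] VW by blast
  have "a \<otimes> b \<in> E" if "a \<in> D" "b \<in> D" for a b
  proof -
    have "(a, b) \<in> ?W" using that D(2) VW(5) by (intro subsetD[OF VW(5)]) auto
    thus ?thesis using U(3) by auto
  qed
  with D(1) show ?thesis by (intro bexI[of _ D]) auto
qed

lemma nhds_preimage:
  assumes "E \<in> \<B>"
  shows "\<exists>D\<in>\<B>. f ` D \<subseteq> E"
proof -
  obtain U where U: "openin T U" "\<one> \<in> U" "U \<subseteq> E"
    using nhds_open[OF assms] by blast
  have "openin T {x \<in> topspace T. f x \<in> U}"
    by (rule openin_continuous_map_preimage[OF f_cont U(1)])
  then obtain D where "D \<in> \<B>" "D \<subseteq> {x \<in> topspace T. f x \<in> U}"
    using nhds_base[of "{x \<in> topspace T. f x \<in> U}"] U(2) by (auto simp: topspace_eq f_one)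
  with U(3) show ?thesis by blast
qed

text \<open>The identity is a fixed point of \<open>f\<close>, so a chain may wait there for any number of steps.\<close>

lemma wait_at_one: "\<one> \<in> E \<Longrightarrow> (\<one>, \<one>) \<in> chain_step G f E ^^ n"
  by (induction n) (auto simp: chain_step_def f_one)

text \<open>Since \<open>f\<close> is a homomorphism and \<open>G\<close> is abelian, the error of a product of two steps is the
  product of their errors.\<close>

lemma chain_mult:
  assumes D: "\<And>a b. a \<in> D \<Longrightarrow> b \<in> D \<Longrightarrow> a \<otimes> b \<in> E"
    and "(x, x') \<in> chain_step G f D ^^ n" "(y, y') \<in> chain_step G f D ^^ n"
  shows "(x \<otimes> y, x' \<otimes> y') \<in> chain_step G f E ^^ n"
  using assms(2,3)
proof (induction n arbitrary: x' y')
  case 0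
  thus ?case by simp
next
  case (Suc n)
  then obtain u v where u: "(x, u) \<in> chain_step G f D ^^ n" "(u, x') \<in> chain_step G f D"
    and v: "(y, v) \<in> chain_step G f D ^^ n" "(v, y') \<in> chain_step G f D"
    by (auto elim!: relpow_Suc_E)
  have c: "u \<in> carrier G" "x' \<in> carrier G" "v \<in> carrier G" "y' \<in> carrier G"
    using u(2) v(2) by (auto simp: chain_step_def)
  have "f (u \<otimes> v) \<otimes> inv (x' \<otimes> y') = (f u \<otimes> inv x') \<otimes> (f v \<otimes> inv y')"
    using c by (simp add: f_mult f_closed inv_mult m_ac)
  hence "(u \<otimes> v, x' \<otimes> y') \<in> chain_step G f E"
    using c u(2) v(2) D by (auto simp: chain_step_def)
  with Suc.IH[OF u(1) v(1)] show ?case by auto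
qed

text \<open>For \<open>chain_mult\<close> the two chains need a common length. A chain starting at \<open>\<one>\<close> is extended
  by waiting there first, a chain ending at \<open>\<one>\<close> by waiting there last.\<close>

lemma chain_mult_from_one:
  assumes D: "D \<in> \<B>" "\<And>a b. a \<in> D \<Longrightarrow> b \<in> D \<Longrightarrow> a \<otimes> b \<in> E"
    and "(\<one>, x) \<in> (chain_step G f D)\<^sup>+" "(\<one>, y) \<in> (chain_step G f D)\<^sup>+"
  shows "(\<one>, x \<otimes> y) \<in> (chain_step G f E)\<^sup>+"
proof -
  from assms(3,4) obtain m n where m: "m > 0" "(\<one>, x) \<in> chain_step G f D ^^ m"
    and n: "n > 0" "(\<one>, y) \<in> chain_step G f D ^^ n"
    unfolding trancl_power by blast
  note wait = wait_at_one[OF nhds_one[OF D(1)]]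
  have "(\<one>, x) \<in> chain_step G f D ^^ (n + m)" "(\<one>, y) \<in> chain_step G f D ^^ (m + n)"
    using wait m(2) n(2) unfolding relpow_add by blast+
  hence "(\<one> \<otimes> \<one>, x \<otimes> y) \<in> chain_step G f E ^^ (m + n)"
    by (intro chain_mult[OF D(2)]) (simp_all add: add.commute)
  thus ?thesis
    using m(1) unfolding trancl_power by (intro exI[of _ "m + n"]) simp
qed

lemma chain_mult_to_one:
  assumes D: "D \<in> \<B>" "\<And>a b. a \<in> D \<Longrightarrow> b \<in> D \<Longrightarrow> a \<otimes> b \<in> E"
    and "(x, \<one>) \<in> (chain_step G f D)\<^sup>+" "(y, \<one>) \<in> (chain_step G f D)\<^sup>+"
  shows "(x \<otimes> y, \<one>) \<in> (chain_step G f E)\<^sup>+"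
proof -
  from assms(3,4) obtain m n where m: "m > 0" "(x, \<one>) \<in> chain_step G f D ^^ m"
    and n: "n > 0" "(y, \<one>) \<in> chain_step G f D ^^ n"
    unfolding trancl_power by blast
  note wait = wait_at_one[OF nhds_one[OF D(1)]]
  have "(x, \<one>) \<in> chain_step G f D ^^ (m + n)" "(y, \<one>) \<in> chain_step G f D ^^ (n + m)"
    using wait m(2) n(2) unfolding relpow_add by blast+
  hence "(x \<otimes> y, \<one> \<otimes> \<one>) \<in> chain_step G f E ^^ (m + n)"
    by (intro chain_mult[OF D(2)]) (simp_all add: add.commute)
  thus ?thesis
    using m(1) unfolding trancl_power by (intro exI[of _ "m + n"]) simp
qed

text \<open>Because \<open>\<phi>\<close> commutes with \<open>f\<close>, it sends the error of a step to the error of the image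
  step, and the assumption \<open>cont\<close> is its continuity at the identity. Inversion gives closure of
  the chain component under inverses, and \<open>\<phi> = f\<close> gives its invariance.\<close>

lemma chain_reaches_image:
  assumes hom: "\<phi> \<in> hom G G" and comm: "\<And>x. x \<in> carrier G \<Longrightarrow> f (\<phi> x) = \<phi> (f x)"
    and cont: "\<And>E. E \<in> \<B> \<Longrightarrow> \<exists>D\<in>\<B>. \<phi> ` D \<subseteq> E"
    and xy: "chain_reaches G \<B> f x y"
  shows "chain_reaches G \<B> f (\<phi> x) (\<phi> y)"
  unfolding chain_reaches_iff_trancl
proof
  fix E assume "E \<in> \<B>"
  then obtain D where D: "D \<in> \<B>" "\<phi> ` D \<subseteq> E" using cont by blast
  have closed: "\<phi> u \<in> carrier G" if "u \<in> carrier G" for u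
    using hom that by (auto simp: hom_def)
  have step: "(\<phi> u, \<phi> v) \<in> chain_step G f E" if "(u, v) \<in> chain_step G f D" for u v
  proof -
    have c: "u \<in> carrier G" "v \<in> carrier G" "f u \<otimes> inv v \<in> D"
      using that by (auto simp: chain_step_def)
    have "\<phi> (inv v) = inv (\<phi> v)"
      using group_hom.hom_inv[of G G \<phi> v] hom is_group c(2)
      by (simp add: group_hom_def group_hom_axioms_def)
    hence "f (\<phi> u) \<otimes> inv (\<phi> v) = \<phi> (f u \<otimes> inv v)"
      using c by (simp add: comm hom_mult[OF hom] f_closed)
    thus ?thesis using c D(2) closed by (auto simp: chain_step_def)
  qed
  have "(x, y) \<in> (chain_step G f D)\<^sup>+"
    using xy D(1) by (simp add: chain_reaches_iff_trancl)
  thus "(\<phi> x, \<phi> y) \<in> (chain_step G f E)\<^sup>+"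
    by (induction rule: trancl_induct) (blast intro: step trancl_into_trancl)+
qed

lemma chain_reaches_inv:
  assumes "chain_reaches G \<B> f x y"
  shows "chain_reaches G \<B> f (inv x) (inv y)"
proof (rule chain_reaches_image[where \<phi> = "\<lambda>x. inv x", OF _ _ _ assms])
  show "(\<lambda>x. inv x) \<in> hom G G" by (simp add: hom_def inv_mult)
  show "\<exists>D\<in>\<B>. (\<lambda>x. inv x) ` D \<subseteq> E" if "E \<in> \<B>" for E
    using equalityD1[OF nhds_inv_image[OF that]] that by (rule rev_bexI[rotated])
qed (rule f_inv)

lemma chain_reaches_f:
  "chain_reaches G \<B> f x y \<Longrightarrow> chain_reaches G \<B> f (f x) (f y)"
  using chain_reaches_image[where \<phi> = f] f_hom nhds_preimage by blast

lemma chain_reaches_one: "chain_reaches G \<B> f \<one> \<one>"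
  unfolding chain_reaches_iff_trancl
proof
  fix E assume "E \<in> \<B>"
  hence "(\<one>, \<one>) \<in> chain_step G f E"
    using wait_at_one[of E 1] nhds_one by simp
  thus "(\<one>, \<one>) \<in> (chain_step G f E)\<^sup>+" by (rule r_into_trancl)
qed

lemma subgroup_chain_component: "subgroup (chain_component G \<B> f) G"
proof (rule subgroup.intro)
  show "x \<otimes> y \<in> chain_component G \<B> f"
    if "x \<in> chain_component G \<B> f" "y \<in> chain_component G \<B> f" for x y
  proof -
    have xy: "x \<in> carrier G" "y \<in> carrier G"
      using that by (auto simp: chain_component_def)
    have "(x \<otimes> y, \<one>) \<in> (chain_step G f E)\<^sup>+ \<and> (\<one>, x \<otimes> y) \<in> (chain_step G f E)\<^sup>+"
      if E: "E \<in> \<B>" for E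
    proof -
      obtain D where D: "D \<in> \<B>" "\<And>a b. a \<in> D \<Longrightarrow> b \<in> D \<Longrightarrow> a \<otimes> b \<in> E"
        using nhds_square_root[OF E] by blast
      show ?thesis
        using chain_mult_to_one[OF D] chain_mult_from_one[OF D] D(1)
          \<open>x \<in> chain_component G \<B> f\<close> \<open>y \<in> chain_component G \<B> f\<close>
        by (simp add: chain_component_def chain_reaches_iff_trancl)
    qed
    with xy show ?thesis by (simp add: chain_component_def chain_reaches_iff_trancl)
  qed
  show "inv x \<in> chain_component G \<B> f" if "x \<in> chain_component G \<B> f" for x
    using that chain_reaches_inv[of x \<one>] chain_reaches_inv[of \<one> x]
    by (simp add: chain_component_def)
  show "chain_component G \<B> f \<subseteq> carrier G"
    unfolding chain_component_def by blast
  show "\<one> \<in> chain_component G \<B> f"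
    unfolding chain_component_def using chain_reaches_one by blast
qed

lemma chain_component_invariant: "f ` chain_component G \<B> f \<subseteq> chain_component G \<B> f"
proof (rule image_subsetI)
  fix x assume x: "x \<in> chain_component G \<B> f"
  thus "f x \<in> chain_component G \<B> f"
    using chain_reaches_f[of x \<one>] chain_reaches_f[of \<one> x]
    by (simp add: chain_component_def f_closed f_one)
qed

section \<open>Chains in the quotient\<close>

text \<open>The representative of each coset along the chain is chosen so that the subgroup part of the
  error vanishes, which is why the lifted chain has the same \<open>E\<close>, not an enlargement of it.\<close>

lemma lift_quotient_chain:
  assumes H: "subgroup H G" "f ` H \<subseteq> H" and E: "E \<subseteq> carrier G"
    and chain: "(X, Y) \<in> (chain_step (G Mod H) (induced_map G H f) (coset_proj G H ` E))\<^sup>+"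
    and x: "x \<in> X"
  shows "\<exists>y\<in>Y. (x, y) \<in> (chain_step G f E)\<^sup>+"
proof -
  interpret H: normal H G by (rule subgroup_imp_normal[OF H(1)])
  have lift_step: "\<exists>z\<in>Z. (y, z) \<in> chain_step G f E"
    if step: "(Y, Z) \<in> chain_step (G Mod H) (induced_map G H f) (coset_proj G H ` E)"
      and y: "y \<in> Y" for y Y Z
  proof -
    from step have "Y \<in> carrier (G Mod H)" and ZG: "Z \<in> carrier (G Mod H)"
      and diff: "induced_map G H f Y \<otimes>\<^bsub>G Mod H\<^esub> inv\<^bsub>G Mod H\<^esub> Z \<in> coset_proj G H ` E"
      unfolding chain_step_def by simp_all
    then obtain y0 z where y0: "y0 \<in> carrier G" "Y = H #> y0"
      and z: "z \<in> carrier G" "Z = H #> z"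
      by (auto simp: carrier_FactGroup)
    have yG: "y \<in> carrier G"
      using y y0 H.subset r_coset_subset_G by blast
    have "Y = H #> y"
      using repr_independence[OF _ y0(1) H(1)] y y0(2) by simp
    hence "induced_map G H f Y = H #> f y"
      using induced_map_coset[OF is_group H(1) f_hom H(2) yG] by simp
    moreover have "inv\<^bsub>G Mod H\<^esub> Z = H #> inv z"
      using H.inv_FactGroup[OF ZG] H.rcos_inv[OF z(1)] z(2) by simp
    ultimately have "H #> (f y \<otimes> inv z) \<in> coset_proj G H ` E"
      using diff H.rcos_sum[OF f_closed[OF yG] inv_closed[OF z(1)]]
      by (simp only: mult_FactGroup)
    then obtain e where e: "e \<in> E" "H #> (f y \<otimes> inv z) = H #> e"
      by (elim imageE)
    have "f y \<otimes> inv z \<in> H #> e"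
      using rcos_self[OF _ H(1), of "f y \<otimes> inv z"] e(2) f_closed[OF yG] z(1) by simp
    then obtain h where h: "h \<in> H" "f y \<otimes> inv z = h \<otimes> e"
      by (auto simp: r_coset_def)
    have c: "h \<in> carrier G" "e \<in> carrier G" using h(1) e(1) E H.subset by auto
    \<comment> \<open>\<open>h \<otimes> z\<close> represents the same coset as \<open>z\<close>, and this step has error exactly \<open>e\<close>.\<close>
    have "f y \<otimes> inv (h \<otimes> z) = inv h \<otimes> (f y \<otimes> inv z)"
      using c z(1) yG by (simp add: f_closed inv_mult m_ac)
    also have "\<dots> = e" using c by (simp add: h(2) m_assoc[symmetric])
    finally have "(y, h \<otimes> z) \<in> chain_step G f E"
      using c z(1) yG e(1) by (simp add: chain_step_def)
    moreover have "h \<otimes> z \<in> Z" using h(1) z(2) by (auto simp: r_coset_def)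
    ultimately show ?thesis by blast
  qed
  from chain show ?thesis
  proof (induction rule: trancl_induct)
    case (base Y)
    thus ?case using lift_step[OF _ x] by blast
  next
    case (step Y Z)
    then obtain y where "y \<in> Y" "(x, y) \<in> (chain_step G f E)\<^sup>+" by blast
    thus ?case using lift_step[OF step(2)] by (blast intro: trancl_into_trancl)
  qed
qed

text \<open>The two directions of chain reachability are not symmetric here: lifts can be prescribed at
  their start only. Towards \<open>\<one>\<close> the uncontrolled endpoint is followed by a further chain, whereas
  away from \<open>\<one>\<close> it lies in \<open>X\<close> but is not \<open>x\<close> itself and has to be moved by multiplication.\<close>

lemma quotient_chain_component_trivial:
  assumes H_def: "H = chain_component G \<B> f"
    and X: "X \<in> chain_component (G Mod H) (quotient_nhds G H \<B>) (induced_map G H f)"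
  shows "X = H"
proof -
  have H: "subgroup H G" "f ` H \<subseteq> H"
    unfolding H_def by (rule subgroup_chain_component, rule chain_component_invariant)
  interpret H: subgroup H G by (rule H(1))
  let ?R = "\<lambda>E. (chain_step (G Mod H) (induced_map G H f) (coset_proj G H ` E))\<^sup>+"
  from X obtain x where x: "x \<in> carrier G" "X = H #> x"
    by (auto simp: chain_component_def carrier_FactGroup)
  have xX: "x \<in> X" using rcos_self[OF x(1) H(1)] x(2) by simp
  have chains: "(X, H) \<in> ?R E" "(H, X) \<in> ?R E" if "E \<in> \<B>" for E
    using X that by (auto simp: chain_component_def chain_reaches_iff_trancl quotient_nhds_def)
  have "chain_reaches G \<B> f x \<one>"
    unfolding chain_reaches_iff_trancl
  proof
    fix E assume E: "E \<in> \<B>"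
    obtain h where "h \<in> H" "(x, h) \<in> (chain_step G f E)\<^sup>+"
      using lift_quotient_chain[OF H nhds_subset[OF E] chains(1)[OF E] xX] by blast
    moreover from \<open>h \<in> H\<close> E have "(h, \<one>) \<in> (chain_step G f E)\<^sup>+"
      unfolding H_def chain_component_def chain_reaches_iff_trancl by blast
    ultimately show "(x, \<one>) \<in> (chain_step G f E)\<^sup>+" by (blast intro: trancl_trans)
  qed
  moreover have "chain_reaches G \<B> f \<one> x"
    unfolding chain_reaches_iff_trancl
  proof
    fix E assume "E \<in> \<B>"
    then obtain D where D: "D \<in> \<B>" "\<And>a b. a \<in> D \<Longrightarrow> b \<in> D \<Longrightarrow> a \<otimes> b \<in> E"
      using nhds_square_root by meson
    obtain y where y: "y \<in> X" "(\<one>, y) \<in> (chain_step G f D)\<^sup>+"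
      using lift_quotient_chain[OF H nhds_subset[OF D(1)] chains(2)[OF D(1)] H.one_closed]
      by blast
    then obtain h where h: "h \<in> H" "y = h \<otimes> x"
      using x(2) by (auto simp: r_coset_def)
    \<comment> \<open>Both \<open>y\<close> and \<open>h\<close> depend on the neighborhood, so the product is formed for this \<open>D\<close> alone.\<close>
    have "(\<one>, inv h) \<in> (chain_step G f D)\<^sup>+"
      using H.m_inv_closed[OF h(1)] D(1)
      unfolding H_def chain_component_def chain_reaches_iff_trancl by blast
    from chain_mult_from_one[OF D this y(2)]
    have "(\<one>, inv h \<otimes> y) \<in> (chain_step G f E)\<^sup>+" by blast
    moreover have "inv h \<otimes> y = x"
      using H.mem_carrier[OF h(1)] x(1) by (simp add: h(2) m_assoc[symmetric])
    ultimately show "(\<one>, x) \<in> (chain_step G f E)\<^sup>+" by simp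
  qed
  ultimately have "x \<in> H" using x(1) unfolding H_def chain_component_def by blast
  from coset_join2[OF x(1) H(1) this] show "X = H" unfolding x(2) .
qed

end

theorem proposition3p3:
  fixes G :: "('a, 'b) monoid_scheme" and T :: "'a topology"
    and \<B> :: "'a set set" and f :: "'a \<Rightarrow> 'a"
  assumes "topological_group G T" and "comm_group G" and "compact_space T"
    and "symmetric_nhds_system G T \<B>"
    and "f \<in> iso G G" and "continuous_map T T f"
  shows "chain_component (G Mod chain_component G \<B> f)
           (quotient_nhds G (chain_component G \<B> f) \<B>)
           (induced_map G (chain_component G \<B> f) f)
         = {chain_component G \<B> f}"
proof -
  define H where "H = chain_component G \<B> f"
  interpret abelian_group_endomorphism G T \<B> f
    using assms by (simp add: abelian_group_endomorphism_def abelian_group_endomorphism_axioms_def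
        iso_def)
  have sub: "subgroup H G" and inv: "f ` H \<subseteq> H"
    unfolding H_def by (rule subgroup_chain_component, rule chain_component_invariant)
  interpret N: normal H G by (rule subgroup_imp_normal[OF sub])
  interpret Q: group "G Mod H" by (rule N.factorgroup_is_group)
  have H_carrier: "H \<in> carrier (G Mod H)"
    using Q.one_closed by simp
  have H_fixed: "induced_map G H f H = H"
    using induced_map_coset[OF is_group sub f_hom inv one_closed]
    by (simp add: f_one N.subset)
  have "(H, H) \<in> chain_step (G Mod H) (induced_map G H f) (coset_proj G H ` E)"
    if "E \<in> \<B>" for E
  proof -
    have "H \<otimes>\<^bsub>G Mod H\<^esub> inv\<^bsub>G Mod H\<^esub> H = \<one>\<^bsub>G Mod H\<^esub>"
      by (rule Q.r_inv[OF H_carrier])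
    also have "\<dots> = coset_proj G H \<one>\<^bsub>G\<^esub>" by (simp add: N.subset)
    also have "\<dots> \<in> coset_proj G H ` E" using nhds_one[OF that] by (rule imageI)
    finally show ?thesis
      unfolding chain_step_def using H_carrier by (simp only: mem_Collect_eq case_prod_conv H_fixed)
  qed
  hence "H \<in> chain_component (G Mod H) (quotient_nhds G H \<B>) (induced_map G H f)"
    using H_carrier by (auto simp: chain_component_def chain_reaches_iff_trancl quotient_nhds_def)
  thus ?thesis
    using quotient_chain_component_trivial[OF H_def] unfolding H_def by blast
qed

end
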